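(* Let $\Bbbk$ be a field of characteristic zero and $b\in\Bbbk$. Let $m,n\in\mathbb{N}$ and let $$f(x,y)=\sum_{i=0}^{m}e_{i}x^{m-i}y^{i},\qquad g(x,y)=\sum_{j=0}^{n}l_{j}x^{n-j}y^{j}\qquad(e_i,l_j\in\Bbbk)$$ be two homogeneous elements of $Q(0,b,0)$. Then $$f(x,y)g(x,y)=\sum_{i=0}^{m}\sum_{j=0}^{n}\left(e_il_j\,b^{in-ij}\right)x^{(m+n)-(i+j)}y^{i+j}.$$
   Context: $\mathbb{N}$ includes $0$. $Q(0,b,0)$ (the quantum plane, or Manin's plane) is the associative unital $\Bbbk$-algebra generated by $x,y$ subject to the single relation $yx=bxy$; the set $\{x^{i}y^{j}\mid i,j\in\mathbb{N}\}$ is a $\Bbbk$-basis of it. Convention: $b^0=1$ for every $b\in\Bbbk$. *)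

theory Defs
  imports "HOL-Algebra.QuotRing" "HOL-Algebra.Module" "HOL-Library.Poly_Mapping"
begin

text \<open>
  The free monoid on two letters, written additively (\<open>+\<close> is the noncommutative concatenation,
  \<open>0\<close> is the empty word), because the convolution product of \<^theory>\<open>HOL-Library.Poly_Mapping\<close>
  requires an additive index monoid. Thus \<open>word \<Rightarrow>\<^sub>0 'k\<close> is the free algebra on two generators.
\<close>

datatype letter = LX | LY

datatype word = Word (letters: "letter list")

instantiation word :: monoid_add
begin

definition zero_word :: word where
  "0 = Word []"

definition plus_word :: "word \<Rightarrow> word \<Rightarrow> word" where
  "u + v = Word (letters u @ letters v)"

instance
  by standard (simp_all add: zero_word_def plus_word_def)

end

definition free_algebra :: "('k::field, word \<Rightarrow>\<^sub>0 'k) module" where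
  "free_algebra =
    \<lparr>carrier = UNIV, mult = (*), one = 1, zero = 0, add = (+),
     smult = (\<lambda>c p. Poly_Mapping.single 0 c * p)\<rparr>"

definition free_x :: "word \<Rightarrow>\<^sub>0 'k::field" where
  "free_x = Poly_Mapping.single (Word [LX]) 1"

definition free_y :: "word \<Rightarrow>\<^sub>0 'k::field" where
  "free_y = Poly_Mapping.single (Word [LY]) 1"

text \<open>
  \<open>Idl\<close> is the generated two-sided ideal. It is also closed under scalar multiplication, since
  scalars act as multiplication by elements of the free algebra.
\<close>

definition quantum_ideal :: "'k::field \<Rightarrow> (word \<Rightarrow>\<^sub>0 'k) set" where
  "quantum_ideal b =
    Idl\<^bsub>free_algebra\<^esub> {free_y * free_x - Poly_Mapping.single 0 b * (free_x * free_y)}"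

text \<open>
  The algebra \<open>Q(0,b,0)\<close>, presented by generators \<open>x, y\<close> and the relation \<open>y x = b x y\<close>; its
  elements are the cosets of the ideal. The record type \<open>module\<close> only supplies the operations: its
  locale \<open>algebra\<close> would demand commutativity.
\<close>

definition quantum_plane :: "'k::field \<Rightarrow> ('k, (word \<Rightarrow>\<^sub>0 'k) set) module" where
  "quantum_plane b =
    ring.extend (free_algebra Quot quantum_ideal b)
      (module.fields
        (\<lambda>c A. \<Union>p\<in>A. quantum_ideal b +>\<^bsub>free_algebra\<^esub> (c \<odot>\<^bsub>free_algebra\<^esub> p)))"

definition qx :: "'k::field \<Rightarrow> (word \<Rightarrow>\<^sub>0 'k) set" where
  "qx b = quantum_ideal b +>\<^bsub>free_algebra\<^esub> free_x"

definition qy :: "'k::field \<Rightarrow> (word \<Rightarrow>\<^sub>0 'k) set" where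
  "qy b = quantum_ideal b +>\<^bsub>free_algebra\<^esub> free_y"

lemma ring_free_algebra: "ring (free_algebra :: ('k::field, word \<Rightarrow>\<^sub>0 'k) module)"
proof (rule ringI)
  show "abelian_group (free_algebra :: ('k, word \<Rightarrow>\<^sub>0 'k) module)"
    by (rule abelian_groupI)
      (auto simp: free_algebra_def add.assoc add.commute intro: exI[of _ "- x" for x] left_minus)
  show "Group.monoid (free_algebra :: ('k, word \<Rightarrow>\<^sub>0 'k) module)"
    by (rule monoidI) (auto simp: free_algebra_def mult.assoc)
qed (auto simp: free_algebra_def distrib_left distrib_right)

lemma ideal_quantum_ideal: "ideal (quantum_ideal b) free_algebra"
  unfolding quantum_ideal_def
  by (rule ring.genideal_ideal[OF ring_free_algebra]) (simp add: free_algebra_def)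

lemma quantum_plane_sel:
  "carrier (quantum_plane b) = carrier (free_algebra Quot quantum_ideal b)"
  "monoid.mult (quantum_plane b) = monoid.mult (free_algebra Quot quantum_ideal b)"
  "one (quantum_plane b) = one (free_algebra Quot quantum_ideal b)"
  "zero (quantum_plane b) = zero (free_algebra Quot quantum_ideal b)"
  "add (quantum_plane b) = add (free_algebra Quot quantum_ideal b)"
  by (simp_all add: quantum_plane_def ring.defs module.defs)

lemma ring_quantum_plane: "ring (quantum_plane b)"
proof -
  interpret R: ring "free_algebra Quot quantum_ideal b"
    by (rule ideal.quotient_is_ring[OF ideal_quantum_ideal])
  show ?thesis
  proof (rule ringI)
    show "abelian_group (quantum_plane b)"
      by (rule abelian_groupI; unfold quantum_plane_sel)
        (assumption | rule R.a_closed R.zero_closed R.a_assoc R.a_comm R.l_zero R.add.l_inv_ex[simplified])+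
    show "Group.monoid (quantum_plane b)"
      by (rule monoidI; unfold quantum_plane_sel)
        (assumption | rule R.m_closed R.one_closed R.m_assoc R.l_one R.r_one)+
  qed (simp_all only: quantum_plane_sel R.l_distr R.r_distr)
qed

lemma quantum_plane_mult_coset:
  "(quantum_ideal b +>\<^bsub>free_algebra\<^esub> p) \<otimes>\<^bsub>quantum_plane b\<^esub> (quantum_ideal b +>\<^bsub>free_algebra\<^esub> q)
    = quantum_ideal b +>\<^bsub>free_algebra\<^esub> (p * q)"
  using ideal.rcoset_mult_add[OF ideal_quantum_ideal, of p q b]
  by (simp add: quantum_plane_sel FactRing_def) (simp add: free_algebra_def)

lemma quantum_plane_smult_coset:
  "c \<odot>\<^bsub>quantum_plane b\<^esub> (quantum_ideal b +>\<^bsub>free_algebra\<^esub> p)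
    = quantum_ideal b +>\<^bsub>free_algebra\<^esub> (Poly_Mapping.single 0 c * p)"
proof -
  let ?I = "quantum_ideal b" and ?s = "Poly_Mapping.single 0 c :: word \<Rightarrow>\<^sub>0 'a"
  interpret ideal ?I free_algebra by (rule ideal_quantum_ideal)
  have coset: "?I +>\<^bsub>free_algebra\<^esub> (?s * q) = ?I +>\<^bsub>free_algebra\<^esub> (?s * p)"
    if q: "q \<in> ?I +>\<^bsub>free_algebra\<^esub> p" for q
  proof -
    obtain i where i: "i \<in> ?I" "q = i + p"
      using q by (auto simp: a_r_coset_def' free_algebra_def)
    have "?s * i \<in> ?I"
      using I_l_closed[OF i(1), of ?s] by (simp add: free_algebra_def)
    then have "?s * q \<in> ?I +>\<^bsub>free_algebra\<^esub> (?s * p)"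
      using i(2) by (auto simp: a_r_coset_def' free_algebra_def distrib_left)
    then show ?thesis
      using a_repr_independence'[of "?s * q" "?s * p"] by (simp add: free_algebra_def)
  qed
  have "p \<in> ?I +>\<^bsub>free_algebra\<^esub> p"
    by (rule a_rcos_self) (simp add: free_algebra_def)
  then have "(\<Union>q\<in>?I +>\<^bsub>free_algebra\<^esub> p. ?I +>\<^bsub>free_algebra\<^esub> (?s * q)) = ?I +>\<^bsub>free_algebra\<^esub> (?s * p)"
    using coset by blast
  then show ?thesis
    by (simp add: quantum_plane_def ring.defs module.defs) (simp add: free_algebra_def)
qed

lemma quantum_plane_relation:
  "qy b \<otimes>\<^bsub>quantum_plane b\<^esub> qx b = b \<odot>\<^bsub>quantum_plane b\<^esub> (qx b \<otimes>\<^bsub>quantum_plane b\<^esub> qy b)"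
proof -
  interpret ideal "quantum_ideal b" free_algebra by (rule ideal_quantum_ideal)
  let ?r = "Poly_Mapping.single 0 b * (free_x * free_y) :: word \<Rightarrow>\<^sub>0 'a"
  have "free_y * free_x - ?r \<in> quantum_ideal b"
    unfolding quantum_ideal_def
    by (rule genideal_self'[of "free_y * free_x - ?r"]) (simp add: free_algebra_def)
  then have "free_y * free_x \<in> quantum_ideal b +>\<^bsub>free_algebra\<^esub> ?r"
    by (force simp: a_r_coset_def' free_algebra_def)
  then have "quantum_ideal b +>\<^bsub>free_algebra\<^esub> (free_y * free_x) = quantum_ideal b +>\<^bsub>free_algebra\<^esub> ?r"
    by (rule a_repr_independence'[symmetric]) (simp add: free_algebra_def)
  then show ?thesis
    by (simp add: qx_def qy_def quantum_plane_mult_coset quantum_plane_smult_coset)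
qed

end

theory Submission
  imports Defs
begin

text \<open>The relation \<open>y x = b x y\<close> says that moving one \<open>y\<close> rightwards
  past one \<open>x\<close> costs a factor \<open>b\<close>. Moving \<open>y^i\<close> past
  \<open>x^k\<close> makes \<open>i * k\<close> such exchanges, so
  \<open>y^i x^k = b^(i k) x^k y^i\<close> (\<open>qy_mult_qx_pow\<close> for one \<open>y\<close>,
  then \<open>qy_pow_mult_qx_pow\<close>). In a product of two ordered monomials only the inner
  block \<open>y^i x^s\<close> is out of order, which gives
  \<open>quantum_plane_monomial_mult\<close>. The theorem follows by distributing the product over
  both sums and taking \<open>k = n - j\<close>. The laws for scalars are inherited from the free
  algebra through coset representatives.\<close>

lemma single_zero_mult_commute:
  fixes p :: "'a::monoid_add \<Rightarrow>\<^sub>0 'k::comm_semiring_0"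
  shows "p * Poly_Mapping.single 0 c = Poly_Mapping.single 0 c * p"
proof (induction p rule: update_induct)
  case (update p w d)
  \<comment> \<open>The induction supplies a key \<open>w\<close> outside the support of
    \<open>p\<close>, so overwriting its coefficient 0 amounts to adding a monomial.\<close>
  then have "Poly_Mapping.update w d p = p + Poly_Mapping.single w d"
    by (intro poly_mapping_eqI)
      (auto simp: lookup_update lookup_add lookup_single when_def in_keys_iff)
  with update show ?case
    by (simp add: mult_single mult.commute[of d] distrib_left distrib_right)
qed simp

lemma quantum_plane_elem_coset:
  assumes "A \<in> carrier (quantum_plane b)"
  obtains p where "A = quantum_ideal b +>\<^bsub>free_algebra\<^esub> p"
  using assms by (auto simp: quantum_plane_sel FactRing_def A_RCOSETS_def')

lemma coset_in_quantum_plane: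
  "quantum_ideal b +>\<^bsub>free_algebra\<^esub> p \<in> carrier (quantum_plane b)"
  by (auto simp: quantum_plane_sel FactRing_def A_RCOSETS_def' free_algebra_def)

lemma qx_closed: "qx b \<in> carrier (quantum_plane b)"
  and qy_closed: "qy b \<in> carrier (quantum_plane b)"
  by (simp_all add: qx_def qy_def coset_in_quantum_plane)

lemma quantum_plane_smult_closed:
  "A \<in> carrier (quantum_plane b) \<Longrightarrow> c \<odot>\<^bsub>quantum_plane b\<^esub> A \<in> carrier (quantum_plane b)"
  by (metis quantum_plane_elem_coset quantum_plane_smult_coset coset_in_quantum_plane)

lemma quantum_plane_smult_one:
  "A \<in> carrier (quantum_plane b) \<Longrightarrow> 1 \<odot>\<^bsub>quantum_plane b\<^esub> A = A"
  by (erule quantum_plane_elem_coset) (simp add: quantum_plane_smult_coset)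

lemma quantum_plane_smult_smult:
  assumes "A \<in> carrier (quantum_plane b)"
  shows "c \<odot>\<^bsub>quantum_plane b\<^esub> (d \<odot>\<^bsub>quantum_plane b\<^esub> A) = (c * d) \<odot>\<^bsub>quantum_plane b\<^esub> A"
  using assms
  by (rule quantum_plane_elem_coset)
    (simp add: quantum_plane_smult_coset mult_single flip: mult.assoc)

lemma quantum_plane_smult_mult_left:
  assumes "A \<in> carrier (quantum_plane b)" "B \<in> carrier (quantum_plane b)"
  shows "(c \<odot>\<^bsub>quantum_plane b\<^esub> A) \<otimes>\<^bsub>quantum_plane b\<^esub> B
    = c \<odot>\<^bsub>quantum_plane b\<^esub> (A \<otimes>\<^bsub>quantum_plane b\<^esub> B)"
  using assms
  by (auto elim!: quantum_plane_elem_coset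
      simp: quantum_plane_smult_coset quantum_plane_mult_coset mult.assoc)

text \<open>A scalar acts as left multiplication by a multiple of the empty word. Such elements are
  central in the free algebra, so the scalar can be carried leftwards past a representative of
  \<open>A\<close>.\<close>

lemma quantum_plane_smult_mult_right:
  assumes "A \<in> carrier (quantum_plane b)" "B \<in> carrier (quantum_plane b)"
  shows "A \<otimes>\<^bsub>quantum_plane b\<^esub> (c \<odot>\<^bsub>quantum_plane b\<^esub> B)
    = c \<odot>\<^bsub>quantum_plane b\<^esub> (A \<otimes>\<^bsub>quantum_plane b\<^esub> B)"
proof -
  have "p * (Poly_Mapping.single 0 c * q) = Poly_Mapping.single 0 c * (p * q)"
    for p q :: "word \<Rightarrow>\<^sub>0 'a"
    by (metis mult.assoc single_zero_mult_commute)
  then show ?thesis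
    using assms
    by (auto elim!: quantum_plane_elem_coset
        simp: quantum_plane_smult_coset quantum_plane_mult_coset)
qed

text \<open>As rewrite rules these pull all scalars to the front and merge them, leaving a
  scalar-free product to be rearranged by associativity.\<close>

lemmas quantum_plane_smult =
  quantum_plane_smult_smult quantum_plane_smult_mult_left quantum_plane_smult_mult_right

text \<open>Induction on \<open>k\<close>: once \<open>y\<close> has passed \<open>x^k\<close>, the
  defining relation takes it past the last \<open>x\<close> for one more factor \<open>b\<close>.
  Nothing is divided by \<open>b\<close>, so \<open>b = 0\<close> is covered, with
  \<open>b ^ 0 = 1\<close>.\<close>

lemma qy_mult_qx_pow:
  fixes Q (structure)
  assumes Q: "Q = quantum_plane b"
  shows "qy b \<otimes> qx b [^] (k::nat) = b ^ k \<odot> (qx b [^] k \<otimes> qy b)"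
proof -
  interpret ring Q unfolding Q by (rule ring_quantum_plane)
  note [simp] = qx_closed[of b, folded Q] qy_closed[of b, folded Q]
    quantum_plane_smult_closed[of _ b, folded Q]
    quantum_plane_smult_one[of _ b, folded Q] quantum_plane_smult[of _ b, folded Q]
  show ?thesis
  proof (induction k)
    case (Suc k)
    have "qy b \<otimes> qx b [^] Suc k = (qy b \<otimes> qx b [^] k) \<otimes> qx b"
      by (simp add: m_assoc)
    also have "\<dots> = b ^ k \<odot> (qx b [^] k \<otimes> (qy b \<otimes> qx b))"
      by (simp add: Suc m_assoc)
    also have "\<dots> = b ^ Suc k \<odot> (qx b [^] Suc k \<otimes> qy b)"
      by (simp add: quantum_plane_relation[of b, folded Q] m_assoc mult.commute)
    finally show ?case .
  qed simp
qed

text \<open>Each of the \<open>i\<close> letters \<open>y\<close> pays \<open>b ^ k\<close> to pass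
  the block \<open>x^k\<close>; the induction moves the \<open>y\<close> adjacent to that block
  first.\<close>

lemma qy_pow_mult_qx_pow:
  fixes Q (structure)
  assumes Q: "Q = quantum_plane b"
  shows "qy b [^] (i::nat) \<otimes> qx b [^] (k::nat) = b ^ (i * k) \<odot> (qx b [^] k \<otimes> qy b [^] i)"
proof -
  interpret ring Q unfolding Q by (rule ring_quantum_plane)
  note [simp] = qx_closed[of b, folded Q] qy_closed[of b, folded Q]
    quantum_plane_smult_closed[of _ b, folded Q]
    quantum_plane_smult_one[of _ b, folded Q] quantum_plane_smult[of _ b, folded Q]
  show ?thesis
  proof (induction i)
    case (Suc i)
    have "qy b [^] Suc i \<otimes> qx b [^] k = qy b [^] i \<otimes> (qy b \<otimes> qx b [^] k)"
      by (simp add: m_assoc)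
    also have "\<dots> = b ^ k \<odot> ((qy b [^] i \<otimes> qx b [^] k) \<otimes> qy b)"
      by (simp add: qy_mult_qx_pow[OF Q] m_assoc)
    also have "\<dots> = b ^ (Suc i * k) \<odot> (qx b [^] k \<otimes> qy b [^] Suc i)"
      by (simp add: Suc m_assoc power_add)
    finally show ?case .
  qed simp
qed

text \<open>The four exponents are independent, which keeps truncated subtraction out of the
  computation; homogeneity enters only in the theorem, with \<open>r = m - i\<close> and
  \<open>s = n - j\<close>.\<close>

lemma quantum_plane_monomial_mult:
  fixes Q (structure)
  assumes Q: "Q = quantum_plane b"
  shows "(c \<odot> (qx b [^] (r::nat) \<otimes> qy b [^] (i::nat))) \<otimes> (d \<odot> (qx b [^] (s::nat) \<otimes> qy b [^] (j::nat)))
    = (c * d * b ^ (i * s)) \<odot> (qx b [^] (r + s) \<otimes> qy b [^] (i + j))"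
proof -
  interpret ring Q unfolding Q by (rule ring_quantum_plane)
  note [simp] = qx_closed[of b, folded Q] qy_closed[of b, folded Q]
    quantum_plane_smult_closed[of _ b, folded Q] quantum_plane_smult[of _ b, folded Q]
  have "(c \<odot> (qx b [^] r \<otimes> qy b [^] i)) \<otimes> (d \<odot> (qx b [^] s \<otimes> qy b [^] j))
      = (c * d) \<odot> (qx b [^] r \<otimes> ((qy b [^] i \<otimes> qx b [^] s) \<otimes> qy b [^] j))"
    by (simp add: m_assoc mult.commute)
  also have "\<dots> = (c * d * b ^ (i * s)) \<odot> (qx b [^] (r + s) \<otimes> qy b [^] (i + j))"
    by (simp add: qy_pow_mult_qx_pow[OF Q] m_assoc flip: nat_pow_mult)
  finally show ?thesis .
qed

theorem proposition2p6:
  fixes b :: "'k::field_char_0"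
    and m n :: nat
    and e l :: "nat \<Rightarrow> 'k"
    and f g :: "(word \<Rightarrow>\<^sub>0 'k) set"
    and Q (structure)
  assumes Q: "Q = quantum_plane b"
    and f: "f = (\<Oplus>i\<in>{0..m}. e i \<odot> (qx b [^] (m - i) \<otimes> qy b [^] i))"
    and g: "g = (\<Oplus>j\<in>{0..n}. l j \<odot> (qx b [^] (n - j) \<otimes> qy b [^] j))"
  shows "f \<otimes> g =
    (\<Oplus>i\<in>{0..m}. \<Oplus>j\<in>{0..n}.
      (e i * l j * b ^ (i * n - i * j)) \<odot>
        (qx b [^] (m + n - (i + j)) \<otimes> qy b [^] (i + j)))"
proof -
  interpret ring Q unfolding Q by (rule ring_quantum_plane)
  note [simp] = qx_closed[of b, folded Q] qy_closed[of b, folded Q]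
    quantum_plane_smult_closed[of _ b, folded Q]
  let ?F = "\<lambda>i. e i \<odot> (qx b [^] (m - i) \<otimes> qy b [^] i)"
  let ?G = "\<lambda>j. l j \<odot> (qx b [^] (n - j) \<otimes> qy b [^] j)"
  let ?H = "\<lambda>i j. (e i * l j * b ^ (i * n - i * j)) \<odot>
    (qx b [^] (m + n - (i + j)) \<otimes> qy b [^] (i + j))"
  have summand: "?F i \<otimes> ?G j = ?H i j" if "i \<le> m" "j \<le> n" for i j
  proof -
    \<comment> \<open>Here the bounds on \<open>i\<close> and \<open>j\<close> matter: they keep
      both natural-number differences from being cut off at 0. The exponent of \<open>b\<close>
      arises as \<open>i * (n - j)\<close> and is expanded by
      \<open>diff_mult_distrib2\<close>.\<close>
    have "m - i + (n - j) = m + n - (i + j)"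
      using that by simp
    then show ?thesis
      by (simp only: quantum_plane_monomial_mult[OF Q] diff_mult_distrib2)
  qed
  have "f \<otimes> g = (\<Oplus>i\<in>{0..m}. ?F i \<otimes> g)"
    unfolding f by (rule finsum_ldistr) (auto simp: g)
  also have "\<dots> = (\<Oplus>i\<in>{0..m}. \<Oplus>j\<in>{0..n}. ?F i \<otimes> ?G j)"
    unfolding g by (intro finsum_cong' refl finsum_rdistr) auto
  \<comment> \<open>The congruence rule for sums provides membership in the index ranges, hence the
    bounds that \<open>summand\<close> requires.\<close>
  also have "\<dots> = (\<Oplus>i\<in>{0..m}. \<Oplus>j\<in>{0..n}. ?H i j)"
    by (intro finsum_cong' refl summand) auto
  finally show ?thesis .
qed

end
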